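(* Let $\kappa$ be a limit ordinal, let $(P_\alpha)_{\alpha<\kappa}$ be a projectional sequence in a Banach space $X$, and let $D\subseteq X^*$ be a norming linear subspace such that $D=\bigcup_{\alpha<\kappa}P_\alpha^*D$ and, for each $\alpha<\kappa$, $(P_\alpha X, P_\alpha^*D)$ is a Plichko pair. Then $(X,D)$ is a Plichko pair. (The projections $P_\alpha$ are not assumed to be uniformly bounded.)
   Context: A projection on $X$ is a bounded linear $P:X\to X$ with $P\circ P=P$; $P^*$ denotes its adjoint. For a limit ordinal $\lambda$, a projectional sequence of length $\lambda$ in $X$ is a sequence of projections $(P_\xi)_{\xi<\lambda}$ such that: $\xi<\eta$ implies $P_\xi=P_\eta\circ P_\xi=P_\xi\circ P_\eta$; $P_\delta X=\overline{\bigcup_{\xi<\delta}P_\xi X}$ for every limit ordinal $\delta<\lambda$; and $X=\overline{\bigcup_{\xi<\lambda}P_\xi X}$ (norm closures). A set $D\subseteq X^*$ is norming if $|x|=\sup\{|\phi(x)|/\|\phi\|:\phi\in D\setminus\{0\}\}$ defines an equivalent norm on $X$. If $D\subseteq X^*$ is a norming linear subspace, $(X,D)$ is a Plichko pair if there is a linearly dense set $A\subseteq X$ such that $\{a\in A:y(a)\neq0\}$ is countable for every $y\in D$. For a closed subspace $Y\subseteq X$ and linear $D\subseteq X^*$, $(Y,D)$ is a Plichko pair if $(Y,\{y|_Y:y\in D\})$ is a Plichko pair in the previous sense. *)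

theory Defs
  imports "HOL-Analysis.Analysis"
begin

(* Ordinals are represented by well-ordered index types: a projectional sequence
   of length lambda is indexed by a type 'i::wellorder of order type lambda. *)

definition is_limit_index :: "'i::wellorder \<Rightarrow> bool" where
  "is_limit_index \<delta> \<longleftrightarrow> (\<exists>\<xi>. \<xi> < \<delta>) \<and> (\<forall>\<xi><\<delta>. \<exists>\<eta>. \<xi> < \<eta> \<and> \<eta> < \<delta>)"

definition is_projection :: "('a::real_normed_vector \<Rightarrow>\<^sub>L 'a) \<Rightarrow> bool" where
  "is_projection P \<longleftrightarrow> P o\<^sub>L P = P"

definition projectional_sequence :: "('i::wellorder \<Rightarrow> ('a::real_normed_vector \<Rightarrow>\<^sub>L 'a)) \<Rightarrow> bool" where
  "projectional_sequence P \<longleftrightarrow>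
     (\<forall>\<xi>. is_projection (P \<xi>)) \<and>
     (\<forall>\<xi> \<eta>. \<xi> < \<eta> \<longrightarrow> P \<xi> = P \<eta> o\<^sub>L P \<xi> \<and> P \<xi> = P \<xi> o\<^sub>L P \<eta>) \<and>
     (\<forall>\<delta>. is_limit_index \<delta> \<longrightarrow>
        range (blinfun_apply (P \<delta>)) = closure (\<Union>\<xi>\<in>{..<\<delta>}. range (blinfun_apply (P \<xi>)))) \<and>
     UNIV = closure (\<Union>\<xi>. range (blinfun_apply (P \<xi>)))"

definition dual_norm_on :: "'a::real_normed_vector set \<Rightarrow> ('a \<Rightarrow> real) \<Rightarrow> real" where
  "dual_norm_on Y \<phi> = (SUP y\<in>{y\<in>Y. norm y \<le> 1}. \<bar>\<phi> y\<bar>)"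

(* D (restricted to Y) is norming on Y: the quantity
   |y| = sup { |phi y| / ||phi|_Y|| : phi in D, phi|_Y <> 0 }  (sup of the empty set = 0)
   satisfies c ||y|| <= |y| for some c > 0 (|y| <= ||y|| holds automatically). *)
definition norming_on :: "'a::real_normed_vector set \<Rightarrow> ('a \<Rightarrow> real) set \<Rightarrow> bool" where
  "norming_on Y D \<longleftrightarrow>
     (\<exists>c>0. \<forall>y\<in>Y. \<forall>b\<ge>0.
        (\<forall>\<phi>\<in>D. (\<exists>z\<in>Y. \<phi> z \<noteq> 0) \<longrightarrow> \<bar>\<phi> y\<bar> / dual_norm_on Y \<phi> \<le> b) \<longrightarrow> c * norm y \<le> b)"

(* (Y, D) is a Plichko pair (D linear, given separately) *)
definition plichko_pair :: "'a::real_normed_vector set \<Rightarrow> ('a \<Rightarrow> real) set \<Rightarrow> bool" where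
  "plichko_pair Y D \<longleftrightarrow> norming_on Y D \<and>
     (\<exists>A\<subseteq>Y. closure (span A) = Y \<and> (\<forall>\<phi>\<in>D. countable {a\<in>A. \<phi> a \<noteq> 0}))"

end

theory Submission
  imports Defs
begin

text \<open>
  Take the set \<open>A\<close> made of \<open>A\<^sub>0\<close> and all \<open>(P\<^bsub>\<alpha>+1\<^esub> - P\<^sub>\<alpha>) A\<^bsub>\<alpha>+1\<^esub>\<close>, where \<open>A\<^sub>\<alpha>\<close> witnesses the
  Plichko property of the range of \<open>P\<^sub>\<alpha>\<close>. It has countable supports on \<open>D\<close> once every
  \<open>\<phi> \<in> D\<close> satisfies \<open>\<phi> P\<^bsub>\<alpha>+1\<^esub> \<noteq> \<phi> P\<^sub>\<alpha>\<close> for only countably many \<open>\<alpha>\<close>. By induction this reduces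
  to showing that for \<open>\<delta>\<close> of uncountable cofinality \<open>\<phi> P\<^sub>\<delta> = \<phi> P\<^sub>\<beta>\<close> for some \<open>\<beta> < \<delta>\<close>.
  Some bound \<open>N\<close> holds for \<open>\<parallel>P\<^sub>\<xi>\<parallel>\<close> for cofinally many \<open>\<xi> < \<delta>\<close>, so one can choose an increasing
  sequence \<open>\<alpha>\<^sub>n\<close> of such indices for which the range of \<open>P\<close> at \<open>\<alpha>\<^bsub>n+1\<^esub>\<close> contains the countable
  supports of \<open>\<phi>\<close> and \<open>\<phi> P\<close> at \<open>\<alpha>\<^sub>n\<close> in \<open>A\<^sub>\<delta>\<close>. With \<open>\<beta> = sup \<alpha>\<^sub>n\<close> the projections at \<open>\<alpha>\<^sub>n\<close>
  converge pointwise to \<open>P\<^sub>\<beta>\<close>, and \<open>\<phi>\<close> and \<open>\<phi> P\<^sub>\<beta>\<close> agree on \<open>A\<^sub>\<delta>\<close>.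
\<close>

section \<open>Linear density and closed subspaces\<close>

lemma blinfun_closure_span_subset:
  fixes T :: "'a::real_normed_vector \<Rightarrow>\<^sub>L 'b::real_normed_vector"
  assumes "\<And>a. a \<in> A \<Longrightarrow> T a \<in> V" "subspace V" "closed V" "x \<in> closure (span A)"
  shows "T x \<in> V"
proof -
  have "span A \<subseteq> T -` V"
  proof (rule span_minimal)
    show "A \<subseteq> T -` V" using assms(1) by auto
    show "subspace (T -` V)"
      using assms(2) by (auto simp: subspace_def blinfun.add_right blinfun.scaleR_right)
  qed
  then have "T ` closure (span A) \<subseteq> V"
    by (intro image_closure_subset continuous_intros assms(3)) auto
  then show ?thesis using assms(4) by blast
qed

lemma subspace_closure:
  fixes V :: "'a::real_normed_vector set"
  assumes "subspace V"
  shows "subspace (closure V)"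
proof (rule subspaceI)
  show "0 \<in> closure V" using assms closure_subset subspace_0 by blast
next
  fix x y assume "x \<in> closure V" "y \<in> closure V"
  then obtain f g where "\<And>n. f n \<in> V" "f \<longlonglongrightarrow> x" "\<And>n. g n \<in> V" "g \<longlonglongrightarrow> y"
    unfolding closure_sequential by blast
  then show "x + y \<in> closure V"
    unfolding closure_sequential
    by (intro exI[of _ "\<lambda>n. f n + g n"]) (auto intro: tendsto_add subspace_add[OF assms])
next
  fix c :: real and x assume "x \<in> closure V"
  then obtain f where "\<And>n. f n \<in> V" "f \<longlonglongrightarrow> x"
    unfolding closure_sequential by blast
  then show "c *\<^sub>R x \<in> closure V"
    unfolding closure_sequential
    by (intro exI[of _ "\<lambda>n. c *\<^sub>R f n"])
      (auto intro: tendsto_scaleR subspace_scale[OF assms])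
qed

section \<open>Ranges and pointwise limits in a projectional sequence\<close>

lemma projectional_sequence_comp:
  assumes "projectional_sequence P" "\<xi> \<le> \<eta>"
  shows "P \<xi> (P \<eta> x) = P \<xi> x" "P \<eta> (P \<xi> x) = P \<xi> x"
proof -
  have "P \<xi> o\<^sub>L P \<eta> = P \<xi> \<and> P \<eta> o\<^sub>L P \<xi> = P \<xi>"
    using assms unfolding projectional_sequence_def is_projection_def
    by (metis order_le_less)
  then show "P \<xi> (P \<eta> x) = P \<xi> x" "P \<eta> (P \<xi> x) = P \<xi> x"
    by (metis blinfun_apply_blinfun_compose)+
qed

lemma projectional_sequence_fixes:
  assumes "projectional_sequence P" "\<xi> \<le> \<eta>" "x \<in> range (P \<xi>)"
  shows "P \<eta> x = x"
  using assms projectional_sequence_comp(2) by fastforce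

lemma projectional_sequence_limit:
  assumes "projectional_sequence P" "is_limit_index \<delta>"
  shows "range (P \<delta>) = closure (\<Union>\<xi>\<in>{..<\<delta>}. range (P \<xi>))"
  using assms unfolding projectional_sequence_def by blast

text \<open>A bound along the chosen indices is enough. The point \<open>P \<beta> x\<close> is
  close to some \<open>z\<close> in an earlier range, and \<open>P (\<alpha> n)\<close> fixes
  \<open>z\<close> for large \<open>n\<close>; since
  \<open>P (\<alpha> n) x = P (\<alpha> n) (P \<beta> x)\<close>, the error is at most
  \<open>N + 1\<close> times the distance from \<open>z\<close> to
  \<open>P \<beta> x\<close>.\<close>

lemma projectional_sequence_tendsto:
  fixes P :: "'i::wellorder \<Rightarrow> ('a::real_normed_vector \<Rightarrow>\<^sub>L 'a)"
  assumes ps: "projectional_sequence P" and lim: "is_limit_index \<beta>"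
    and mono: "mono \<alpha>" and less: "\<And>n. \<alpha> n < \<beta>" and cof: "\<And>\<xi>. \<xi> < \<beta> \<Longrightarrow> \<exists>n. \<xi> \<le> \<alpha> n"
    and bdd: "\<And>n. norm (P (\<alpha> n)) \<le> N"
  shows "(\<lambda>n. P (\<alpha> n) x) \<longlonglongrightarrow> P \<beta> x"
proof (rule LIMSEQ_I)
  fix e :: real assume e: "e > 0"
  have N0: "N \<ge> 0" using bdd[of 0] norm_ge_zero order_trans by blast
  define y where "y = P \<beta> x"
  have "y \<in> closure (\<Union>\<xi>\<in>{..<\<beta>}. range (P \<xi>))"
    using projectional_sequence_limit[OF ps lim] y_def by blast
  then obtain z \<xi> where z: "\<xi> < \<beta>" "z \<in> range (P \<xi>)" "dist z y < e / (N + 1)"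
    using e N0 unfolding closure_approachable
    by (metis (no_types, lifting) UN_E add_nonneg_pos divide_pos_pos lessThan_iff zero_less_one)
  obtain m where m: "\<xi> \<le> \<alpha> m" using cof z(1) by blast
  show "\<exists>m. \<forall>n\<ge>m. norm (P (\<alpha> n) x - P \<beta> x) < e"
  proof (intro exI allI impI)
    fix n assume "n \<ge> m"
    then have "\<xi> \<le> \<alpha> n" using m mono by (meson monoD order_trans)
    then have Pz: "P (\<alpha> n) z = z" using projectional_sequence_fixes[OF ps] z(2) by blast
    have "P (\<alpha> n) x = P (\<alpha> n) y"
      unfolding y_def using projectional_sequence_comp(1)[OF ps] less by (metis less_imp_le)
    then have "P (\<alpha> n) x - P \<beta> x = P (\<alpha> n) (y - z) + (z - y)"
      by (simp add: blinfun.diff_right Pz y_def)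
    then have "norm (P (\<alpha> n) x - P \<beta> x) \<le> norm (P (\<alpha> n) (y - z)) + norm (z - y)"
      by (metis norm_triangle_ineq)
    also have "norm (P (\<alpha> n) (y - z)) \<le> N * norm (y - z)"
      using norm_blinfun[of "P (\<alpha> n)" "y - z"] bdd[of n]
      by (meson mult_right_mono norm_ge_zero order_trans)
    finally have "norm (P (\<alpha> n) x - P \<beta> x) \<le> (N + 1) * dist z y"
      by (simp add: dist_norm norm_minus_commute algebra_simps)
    also have "\<dots> < e" using z(3) N0 by (simp add: field_simps)
    finally show "norm (P (\<alpha> n) x - P \<beta> x) < e" .
  qed
qed

section \<open>Stabilization and jumps of a functional along the sequence\<close>

lemma functional_projection_stabilizes:
  fixes P :: "'i::wellorder \<Rightarrow> ('a::real_normed_vector \<Rightarrow>\<^sub>L 'a)" and \<phi> :: "'a \<Rightarrow>\<^sub>L real"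
  assumes ps: "projectional_sequence P"
    and uncountable_cof: "\<And>S. countable S \<Longrightarrow> S \<subseteq> {..<\<delta>} \<Longrightarrow> \<exists>\<eta><\<delta>. \<forall>\<xi>\<in>S. \<xi> < \<eta>"
    and A: "closure (span A) = range (P \<delta>)"
    and supp: "countable {a \<in> A. \<phi> a \<noteq> 0}"
    and suppP: "\<And>\<xi>. \<xi> < \<delta> \<Longrightarrow> countable {a \<in> A. \<phi> (P \<xi> a) \<noteq> 0}"
  shows "\<exists>\<beta><\<delta>. \<forall>x. \<phi> (P \<delta> x) = \<phi> (P \<beta> x)"
proof -
  have lim\<delta>: "is_limit_index \<delta>"
    unfolding is_limit_index_def
  proof (intro conjI allI impI)
    show "\<exists>\<xi>. \<xi> < \<delta>" using uncountable_cof[of "{}"] by auto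
    show "\<exists>\<eta>>\<xi>. \<eta> < \<delta>" if "\<xi> < \<delta>" for \<xi>
      using uncountable_cof[of "{\<xi>}"] that by auto
  qed
  \<comment> \<open>Uncountable cofinality makes the union of the earlier ranges closed: the indices
    of a convergent sequence lie below one \<open>\<eta>\<close>, and continuity of
    \<open>P \<eta>\<close> passes to the limit.\<close>
  have ex_range: "\<exists>\<xi><\<delta>. x \<in> range (P \<xi>)" if "x \<in> range (P \<delta>)" for x
  proof -
    have "x \<in> closure (\<Union>\<xi>\<in>{..<\<delta>}. range (P \<xi>))"
      using that projectional_sequence_limit[OF ps lim\<delta>] by simp
    then obtain f where f: "\<And>n. f n \<in> (\<Union>\<xi>\<in>{..<\<delta>}. range (P \<xi>))" "f \<longlonglongrightarrow> x"
      by (auto simp: closure_sequential simp del: UN_iff)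
    then have "\<forall>n. \<exists>\<xi>. \<xi> < \<delta> \<and> f n \<in> range (P \<xi>)" by blast
    then obtain g where g: "\<And>n. g n < \<delta>" "\<And>n. f n \<in> range (P (g n))"
      by metis
    obtain \<eta> where \<eta>: "\<eta> < \<delta>" "\<And>n. g n < \<eta>"
      using uncountable_cof[of "range g"] g(1) by auto
    have "P \<eta> (f n) = f n" for n
      using projectional_sequence_fixes[OF ps] g(2) \<eta>(2) less_imp_le by metis
    moreover have "(\<lambda>n. P \<eta> (f n)) \<longlonglongrightarrow> P \<eta> x"
      by (intro tendsto_intros f(2))
    ultimately have "P \<eta> x = x" using f(2) LIMSEQ_unique by simp
    then show ?thesis using \<eta>(1) by (metis rangeI)
  qed
  \<comment> \<open>If each \<open>n\<close> failed beyond some \<open>g n\<close>, then the norm at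
    an index above all \<open>g n\<close> would exceed every natural number.\<close>
  obtain N :: nat where N: "\<And>\<xi>. \<xi> < \<delta> \<Longrightarrow> \<exists>\<eta>. \<xi> < \<eta> \<and> \<eta> < \<delta> \<and> norm (P \<eta>) \<le> real N"
  proof -
    have "\<exists>N. \<forall>\<xi><\<delta>. \<exists>\<eta>. \<xi> < \<eta> \<and> \<eta> < \<delta> \<and> norm (P \<eta>) \<le> real N"
    proof (rule ccontr)
      assume "\<not> ?thesis"
      then obtain g where g: "\<And>n. g n < \<delta>"
        "\<And>n \<eta>. g n < \<eta> \<Longrightarrow> \<eta> < \<delta> \<Longrightarrow> \<not> norm (P \<eta>) \<le> real n"
        by metis
      obtain \<eta> where "\<eta> < \<delta>" "\<And>n. g n < \<eta>"
        using uncountable_cof[of "range g"] g(1) by auto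
      then show False using g(2) real_arch_simple by blast
    qed
    then show ?thesis using that by blast
  qed
  define good where "good \<xi> \<eta> \<longleftrightarrow>
    \<xi> < \<eta> \<and> {a \<in> A. \<phi> a \<noteq> 0} \<union> {a \<in> A. \<phi> (P \<xi> a) \<noteq> 0} \<subseteq> range (P \<eta>)" for \<xi> \<eta>
  have A\<delta>: "A \<subseteq> range (P \<delta>)"
    using A closure_subset span_superset by blast
  have step: "\<exists>\<eta>. (\<eta> < \<delta> \<and> norm (P \<eta>) \<le> real N) \<and> good \<xi> \<eta>" if \<xi>: "\<xi> < \<delta>" for \<xi>
  proof -
    let ?B = "{a \<in> A. \<phi> a \<noteq> 0} \<union> {a \<in> A. \<phi> (P \<xi> a) \<noteq> 0}"
    have "\<forall>a\<in>?B. \<exists>\<zeta><\<delta>. a \<in> range (P \<zeta>)" using ex_range A\<delta> by blast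
    from bchoice[OF this] obtain h where h: "\<forall>a\<in>?B. h a < \<delta> \<and> a \<in> range (P (h a))" ..
    have "countable (insert \<xi> (h ` ?B))" using supp suppP[OF \<xi>] by simp
    moreover have "insert \<xi> (h ` ?B) \<subseteq> {..<\<delta>}" using h \<xi> by blast
    ultimately obtain \<zeta> where \<zeta>: "\<zeta> < \<delta>" "\<forall>\<xi>\<in>insert \<xi> (h ` ?B). \<xi> < \<zeta>"
      using uncountable_cof by blast
    obtain \<eta> where \<eta>: "\<zeta> < \<eta>" "\<eta> < \<delta>" "norm (P \<eta>) \<le> real N" using N[OF \<zeta>(1)] by blast
    have "a \<in> range (P \<eta>)" if "a \<in> ?B" for a
    proof -
      have "h a \<le> \<eta>" using \<zeta>(2) \<eta>(1) that by (meson imageI insertI2 less_imp_le less_trans)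
      then show ?thesis using projectional_sequence_fixes[OF ps] bspec[OF h that] by (metis rangeI)
    qed
    then have "good \<xi> \<eta>" unfolding good_def using \<zeta>(2) \<eta>(1) by auto
    then show ?thesis using \<eta> by blast
  qed
  have "\<exists>\<alpha>. \<forall>n. (\<alpha> n < \<delta> \<and> norm (P (\<alpha> n)) \<le> real N) \<and> good (\<alpha> n) (\<alpha> (Suc n))"
  proof (rule dependent_nat_choice)
    show "\<exists>\<xi>. \<xi> < \<delta> \<and> norm (P \<xi>) \<le> real N"
      using uncountable_cof[of "{}"] N by auto
  qed (use step in blast)
  then obtain \<alpha> where \<alpha>: "\<And>n. \<alpha> n < \<delta>" "\<And>n. norm (P (\<alpha> n)) \<le> real N"
    "\<And>n. good (\<alpha> n) (\<alpha> (Suc n))" by blast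
  have less_Suc: "\<alpha> n < \<alpha> (Suc n)" for n using \<alpha>(3) good_def by blast
  then have mono: "mono \<alpha>" by (simp add: mono_iff_le_Suc less_imp_le)
  obtain \<beta>' where \<beta>': "\<beta>' < \<delta>" "\<And>n. \<alpha> n < \<beta>'"
    using uncountable_cof[of "range \<alpha>"] \<alpha>(1) by auto
  \<comment> \<open>Minimality makes the \<open>\<alpha> n\<close> cofinal in
    \<open>\<beta>\<close>, and their strict increase makes \<open>\<beta>\<close> a limit
    index.\<close>
  define \<beta> where "\<beta> = (LEAST b. \<forall>n. \<alpha> n < b)"
  have \<beta>: "\<alpha> n < \<beta>" for n
    unfolding \<beta>_def using LeastI[of "\<lambda>b. \<forall>n. \<alpha> n < b" \<beta>'] \<beta>'(2) by blast
  have "\<beta> \<le> \<beta>'" unfolding \<beta>_def using \<beta>'(2) by (intro Least_le) blast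
  then have \<beta>\<delta>: "\<beta> < \<delta>" using \<beta>'(1) by simp
  have cof: "\<exists>n. \<xi> \<le> \<alpha> n" if "\<xi> < \<beta>" for \<xi>
    using that not_less_Least[of \<xi> "\<lambda>b. \<forall>n. \<alpha> n < b"] unfolding \<beta>_def by (meson not_le)
  have lim\<beta>: "is_limit_index \<beta>"
    unfolding is_limit_index_def using \<beta> cof less_Suc by (meson le_less_trans)
  note conv = projectional_sequence_tendsto[OF ps lim\<beta> mono \<beta> cof \<alpha>(2)]
  \<comment> \<open>Either \<open>a\<close> lies in one of the supports, hence in the range at the
    next index, and is fixed by \<open>P \<beta>\<close>; or \<open>\<phi> a\<close> and all
    \<open>\<phi> (P (\<alpha> n) a)\<close> vanish, and so does the limit
    \<open>\<phi> (P \<beta> a)\<close>.\<close>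
  have eqA: "\<phi> a = \<phi> (P \<beta> a)" if a: "a \<in> A" for a
  proof (cases "\<phi> a \<noteq> 0 \<or> (\<exists>n. \<phi> (P (\<alpha> n) a) \<noteq> 0)")
    case True
    then obtain n where "a \<in> range (P (\<alpha> (Suc n)))" using \<alpha>(3) a unfolding good_def by blast
    then show ?thesis using projectional_sequence_fixes[OF ps] \<beta> less_imp_le by metis
  next
    case False
    have "(\<lambda>n. \<phi> (P (\<alpha> n) a)) \<longlonglongrightarrow> \<phi> (P \<beta> a)" by (intro tendsto_intros conv)
    then show ?thesis using False by (simp add: LIMSEQ_const_iff)
  qed
  have "\<phi> (P \<delta> x) = \<phi> (P \<beta> x)" for x
  proof -
    have "(\<phi> - (\<phi> o\<^sub>L P \<beta>)) (P \<delta> x) \<in> {0}"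
      by (rule blinfun_closure_span_subset[where A = A])
        (use eqA A in \<open>auto simp: blinfun.diff_left\<close>)
    then show ?thesis
      using projectional_sequence_comp(1)[OF ps less_imp_le[OF \<beta>\<delta>]]
      by (simp add: blinfun.diff_left)
  qed
  then show ?thesis using \<beta>\<delta> by blast
qed

text \<open>Induction on \<delta>. With a countable cofinal set below \<delta>, the jumps form a
  countable union of smaller instances up to countably many indices; otherwise stabilization leaves
  no jump between some \<open>\<beta> < \<delta>\<close> and \<delta>.\<close>

lemma countable_projection_jumps:
  fixes P :: "'i::wellorder \<Rightarrow> ('a::real_normed_vector \<Rightarrow>\<^sub>L 'a)" and \<phi> :: "'a \<Rightarrow>\<^sub>L real"
    and succ :: "'i \<Rightarrow> 'i"
  assumes ps: "projectional_sequence P"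
    and succ: "\<And>\<alpha> \<delta>. \<alpha> < \<delta> \<Longrightarrow> succ \<alpha> \<le> \<delta>" "\<And>\<alpha>. \<alpha> \<le> succ \<alpha>"
    and A: "\<And>\<delta>. closure (span (A \<delta>)) = range (P \<delta>)"
    and supp: "\<And>\<xi> \<delta>. \<xi> \<le> \<delta> \<Longrightarrow> countable {a \<in> A \<delta>. \<phi> (P \<xi> a) \<noteq> 0}"
  shows "countable {\<alpha>. \<alpha> < \<delta> \<and> (\<exists>x. \<phi> (P (succ \<alpha>) x) \<noteq> \<phi> (P \<alpha> x))}"
proof (induction \<delta> rule: less_induct)
  case (less \<delta>)
  let ?C = "\<lambda>\<delta>. {\<alpha>. \<alpha> < \<delta> \<and> (\<exists>x. \<phi> (P (succ \<alpha>) x) \<noteq> \<phi> (P \<alpha> x))}"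
  show ?case
  proof (cases "\<exists>S. countable S \<and> S \<subseteq> {..<\<delta>} \<and> (\<forall>\<eta><\<delta>. \<exists>\<xi>\<in>S. \<eta> \<le> \<xi>)")
    case True
    then obtain S where S: "countable S" "S \<subseteq> {..<\<delta>}" "\<And>\<eta>. \<eta> < \<delta> \<Longrightarrow> \<exists>\<xi>\<in>S. \<eta> \<le> \<xi>" by blast
    \<comment> \<open>\<open>S\<close> is added because \<open>?C \<xi>\<close> omits \<xi> itself.
      Cofinality is non-strict, so this case includes the least index (\<open>S\<close> empty) and
      successors (\<open>S\<close> a singleton).\<close>
    have "?C \<delta> \<subseteq> S \<union> (\<Union>\<xi>\<in>S. ?C \<xi>)" using S(3) by (fastforce simp: order_le_less)
    moreover have "countable (S \<union> (\<Union>\<xi>\<in>S. ?C \<xi>))" using S(1,2) less by auto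
    ultimately show ?thesis by (rule countable_subset)
  next
    case False
    have A\<delta>: "P \<delta> a = a" if "a \<in> A \<delta>" for a
      using that A[of \<delta>] closure_subset span_superset projectional_sequence_fixes[OF ps order_refl]
      by blast
    have "{a \<in> A \<delta>. \<phi> a \<noteq> 0} = {a \<in> A \<delta>. \<phi> (P \<delta> a) \<noteq> 0}" using A\<delta> by auto
    then have "countable {a \<in> A \<delta>. \<phi> a \<noteq> 0}" using supp[of \<delta> \<delta>] by simp
    moreover have "\<exists>\<eta><\<delta>. \<forall>\<xi>\<in>S. \<xi> < \<eta>" if "countable S" "S \<subseteq> {..<\<delta>}" for S
      using False that by (meson not_le)
    ultimately have "\<exists>\<beta><\<delta>. \<forall>x. \<phi> (P \<delta> x) = \<phi> (P \<beta> x)"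
      using supp by (intro functional_projection_stabilizes[OF ps _ A]) auto
    then obtain \<beta> where \<beta>: "\<beta> < \<delta>" "\<And>x. \<phi> (P \<delta> x) = \<phi> (P \<beta> x)"
      by blast
    \<comment> \<open>Evaluate the identity for \<beta> at \<open>P \<alpha> x\<close>:
      \<open>P \<delta>\<close> fixes this point, and \<open>P \<beta>\<close> sends it to
      \<open>P \<beta> x\<close>.\<close>
    have const: "\<phi> (P \<alpha> x) = \<phi> (P \<beta> x)" if "\<beta> \<le> \<alpha>" "\<alpha> \<le> \<delta>" for \<alpha> x
      by (metis \<beta>(2) projectional_sequence_comp[OF ps] that)
    have "?C \<delta> \<subseteq> ?C \<beta>"
    proof
      fix \<alpha> assume \<alpha>: "\<alpha> \<in> ?C \<delta>"
      have "\<alpha> < \<beta>"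
      proof (rule ccontr)
        assume "\<not> \<alpha> < \<beta>"
        then have "\<beta> \<le> \<alpha>" "\<alpha> \<le> \<delta>" "\<beta> \<le> succ \<alpha>" "succ \<alpha> \<le> \<delta>"
          using \<alpha> succ(1)[of \<alpha> \<delta>] succ(2)[of \<alpha>] by auto
        then have "\<phi> (P (succ \<alpha>) x) = \<phi> (P \<alpha> x)" for x
          by (simp only: const[of \<alpha>] const[of "succ \<alpha>"])
        then show False using \<alpha> by simp
      qed
      then show "\<alpha> \<in> ?C \<beta>" using \<alpha> by simp
    qed
    then show ?thesis using less[OF \<beta>(1)] countable_subset by blast
  qed
qed

section \<open>The linearly dense set with countable supports\<close>

theorem theorem5p3:
  fixes P :: "'i::wellorder \<Rightarrow> ('a::banach \<Rightarrow>\<^sub>L 'a)"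
    and D :: "('a \<Rightarrow>\<^sub>L real) set"
  assumes limit: "\<forall>\<xi>::'i. \<exists>\<eta>. \<xi> < \<eta>"
    and proj: "projectional_sequence P"
    and sub: "subspace D"
    and norming: "norming_on UNIV (blinfun_apply ` D)"
    and union: "D = (\<Union>\<alpha>. (\<lambda>\<phi>. \<phi> o\<^sub>L P \<alpha>) ` D)"
    and pl: "\<forall>\<alpha>. plichko_pair (range (blinfun_apply (P \<alpha>)))
                 ((\<lambda>\<phi>. blinfun_apply (\<phi> o\<^sub>L P \<alpha>)) ` D)"
  shows "plichko_pair UNIV (blinfun_apply ` D)"
proof -
  have "\<forall>\<alpha>. \<exists>A. closure (span A) = range (P \<alpha>) \<and>
      (\<forall>\<phi>\<in>D. countable {a \<in> A. \<phi> (P \<alpha> a) \<noteq> 0})"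
    using pl unfolding plichko_pair_def by (simp add: ball_simps) blast
  then obtain A where A: "\<And>\<alpha>. closure (span (A \<alpha>)) = range (P \<alpha>)"
    and suppA: "\<And>\<alpha> \<phi>. \<phi> \<in> D \<Longrightarrow> countable {a \<in> A \<alpha>. \<phi> (P \<alpha> a) \<noteq> 0}"
    by metis
  \<comment> \<open>The hypothesis \<open>union\<close> makes \<open>D\<close> invariant under
    composition with each \<open>P \<xi>\<close>, so \<open>suppA\<close> applies to the composed
    functional.\<close>
  have supp: "countable {a \<in> A \<delta>. \<phi> (P \<xi> a) \<noteq> 0}" if "\<phi> \<in> D" "\<xi> \<le> \<delta>" for \<phi> \<xi> \<delta>
  proof -
    have "\<phi> o\<^sub>L P \<xi> \<in> D" using union that(1) by blast
    from suppA[OF this, of \<delta>] show ?thesis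
      using projectional_sequence_comp(1)[OF proj that(2)] by simp
  qed
  define succ where "succ \<alpha> = (LEAST \<eta>. \<alpha> < \<eta>)" for \<alpha> :: 'i
  have succ_gt: "\<alpha> < succ \<alpha>" for \<alpha>
    unfolding succ_def using limit by (metis LeastI)
  have succ_le: "succ \<alpha> \<le> \<delta>" if "\<alpha> < \<delta>" for \<alpha> \<delta>
    unfolding succ_def using that by (rule Least_le)
  define z :: 'i where "z = (LEAST x. True)"
  have z_le: "z \<le> \<alpha>" for \<alpha> unfolding z_def by (simp add: Least_le)
  define Q where "Q \<alpha> = P (succ \<alpha>) - P \<alpha>" for \<alpha>
  define B where "B = A z \<union> (\<Union>\<alpha>. Q \<alpha> ` A (succ \<alpha>))"
  have clB: "subspace (closure (span B))" by (intro subspace_closure subspace_span)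
  have B_sub: "B \<subseteq> closure (span B)" using closure_subset span_superset by blast
  \<comment> \<open>At a successor, \<open>y = Q \<alpha> y + P \<alpha> y\<close> splits into a
    part generated by \<open>B\<close> and a part from the previous range; at a limit, the range is
    the closure of the earlier ones.\<close>
  have dense: "range (P \<delta>) \<subseteq> closure (span B)" for \<delta>
  proof (induction \<delta> rule: less_induct)
    case (less \<delta>)
    consider "\<delta> = z" | \<alpha> where "\<alpha> < \<delta>" "\<delta> = succ \<alpha>" | "is_limit_index \<delta>"
    proof (cases "is_limit_index \<delta> \<or> \<delta> = z")
      case False
      then have "z < \<delta>" using z_le[of \<delta>] by (auto simp: order_le_less)
      then obtain \<alpha> where \<alpha>: "\<alpha> < \<delta>" "\<And>\<eta>. \<not> (\<alpha> < \<eta> \<and> \<eta> < \<delta>)"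
        using False unfolding is_limit_index_def by blast
      then have "\<delta> = succ \<alpha>" using succ_gt[of \<alpha>] succ_le[of \<alpha> \<delta>] by fastforce
      then show ?thesis using \<alpha>(1) that(2) by blast
    qed (use that in blast)
    then show ?case
    proof cases
      case 1
      have "closure (span (A z)) \<subseteq> closure (span B)"
        by (intro closure_mono span_mono) (auto simp: B_def)
      then show ?thesis using 1 A by simp
    next
      case (2 \<alpha>)
      show ?thesis
      proof
        fix y assume y: "y \<in> range (P \<delta>)"
        have "Q \<alpha> y \<in> closure (span B)"
        proof (rule blinfun_closure_span_subset[OF _ clB closed_closure])
          show "y \<in> closure (span (A \<delta>))" using y A by simp
          show "Q \<alpha> a \<in> closure (span B)" if "a \<in> A \<delta>" for a
          proof -
            have "Q \<alpha> a \<in> B" unfolding B_def using that 2(2) by blast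
            then show ?thesis using B_sub by blast
          qed
        qed
        moreover have "P \<alpha> y \<in> closure (span B)" using less[OF 2(1)] by blast
        moreover have "y = Q \<alpha> y + P \<alpha> y"
          using projectional_sequence_fixes[OF proj order_refl y] 2(2)
          by (simp add: Q_def blinfun.diff_left)
        ultimately show "y \<in> closure (span B)" using clB subspace_add by metis
      qed
    next
      case 3
      show ?thesis
        unfolding projectional_sequence_limit[OF proj 3]
        by (rule closure_minimal) (use less in auto)
    qed
  qed
  have "closure (\<Union>\<delta>. range (P \<delta>)) \<subseteq> closure (span B)"
    by (rule closure_minimal) (use dense in auto)
  then have univ: "closure (span B) = UNIV"
    using proj unfolding projectional_sequence_def by blast
  have "countable {b \<in> B. \<phi> b \<noteq> 0}" if \<phi>: "\<phi> \<in> D" for \<phi>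
  proof -
    \<comment> \<open>Since \<phi> factors through some \<open>P \<delta>\<close>, it has no jumps
      from \<delta> on, so bounding the jumps below \<delta> suffices.\<close>
    obtain \<delta> \<psi> where "\<phi> = \<psi> o\<^sub>L P \<delta>" using union \<phi> by blast
    then have \<phi>\<delta>: "\<phi> (P \<delta> x) = \<phi> x" for x
      using projectional_sequence_comp(1)[OF proj order_refl] by simp
    let ?C = "{\<alpha>. \<alpha> < \<delta> \<and> (\<exists>x. \<phi> (P (succ \<alpha>) x) \<noteq> \<phi> (P \<alpha> x))}"
    have C: "countable ?C"
      by (rule countable_projection_jumps[OF proj succ_le _ A])
        (use succ_gt supp[OF \<phi>] in \<open>auto simp: less_imp_le\<close>)
    \<comment> \<open>If \<phi> is nonzero at \<open>Q \<alpha> a\<close>, then it is nonzero at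
      \<open>P (succ \<alpha>) a\<close> or at \<open>P \<alpha> a\<close>; either support in
      \<open>A (succ \<alpha>)\<close> is countable.\<close>
    let ?S = "\<lambda>\<alpha>. {a \<in> A (succ \<alpha>). \<phi> (P (succ \<alpha>) a) \<noteq> 0} \<union> {a \<in> A (succ \<alpha>). \<phi> (P \<alpha> a) \<noteq> 0}"
    have Az: "P z a = a" if "a \<in> A z" for a
      using that A[of z] closure_subset span_superset
        projectional_sequence_fixes[OF proj order_refl] by blast
    have "{b \<in> B. \<phi> b \<noteq> 0} \<subseteq> {a \<in> A z. \<phi> (P z a) \<noteq> 0} \<union> (\<Union>\<alpha>\<in>?C. Q \<alpha> ` ?S \<alpha>)"
    proof
      fix b assume b: "b \<in> {b \<in> B. \<phi> b \<noteq> 0}"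
      show "b \<in> {a \<in> A z. \<phi> (P z a) \<noteq> 0} \<union> (\<Union>\<alpha>\<in>?C. Q \<alpha> ` ?S \<alpha>)"
      proof (cases "b \<in> A z")
        case True
        then show ?thesis using b Az by simp
      next
        case False
        then obtain \<alpha> a where a: "a \<in> A (succ \<alpha>)" "b = Q \<alpha> a" using b B_def by blast
        then have ne: "\<phi> (P (succ \<alpha>) a) \<noteq> \<phi> (P \<alpha> a)"
          using b by (auto simp: Q_def blinfun.diff_left blinfun.diff_right)
        have "\<alpha> < \<delta>"
        proof (rule ccontr)
          assume "\<not> \<alpha> < \<delta>"
          then have "\<delta> \<le> \<alpha>" "\<delta> \<le> succ \<alpha>" using succ_gt[of \<alpha>] by auto
          then show False
            using ne \<phi>\<delta> projectional_sequence_comp(1)[OF proj] by metis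
        qed
        then have "\<alpha> \<in> ?C" using ne by blast
        moreover have "a \<in> ?S \<alpha>" using a ne by force
        ultimately show ?thesis using a(2) by blast
      qed
    qed
    moreover have "countable ({a \<in> A z. \<phi> (P z a) \<noteq> 0} \<union> (\<Union>\<alpha>\<in>?C. Q \<alpha> ` ?S \<alpha>))"
      using C supp[OF \<phi>] succ_gt by (intro countable_Un countable_UN countable_image) (auto simp: less_imp_le)
    ultimately show ?thesis by (rule countable_subset)
  qed
  then have "\<forall>\<phi>\<in>blinfun_apply ` D. countable {b \<in> B. \<phi> b \<noteq> 0}" by blast
  then show ?thesis unfolding plichko_pair_def using norming univ by blast
qed

end
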